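(* Let $a,b,c>0$ be constants, let $f:\mathcal E(\mu)\to\mathbb R$ be a smooth scalar field, and consider the Lagrangian on the statistical bundle $$L^{a,b,c}(q,w)=c\left(a^{-1}K_q(aw)-b f(q)\right).$$ The second-order Euler–Lagrange equation of $L^{a,b,c}$, $$\frac{D}{dt}\,\mathrm{Grad}_{e}L^{a,b,c}(q(t),\overset{\star}{q}(t))=\mathrm{Grad}\,L^{a,b,c}(q(t),\overset{\star}{q}(t)),$$ for a smooth curve $q(t)$ in $\mathcal E(\mu)$, is equivalent, by setting $\chi_a(t)=e_{q(t)}(a\overset{\star}{q}(t))$, to the first-order system for $(\chi_a(t),q(t))\in\mathcal E(\mu)\times\mathcal E(\mu)$ $$\begin{cases}\dot\chi_a(t)=a^{-1}\left(\chi_a(t)-q(t)\right)-b\,q(t)\,\mathrm{Grad}f(q(t)),\\[4pt] \dot q(t)=a^{-1}q(t)\left(\log\dfrac{\chi_a(t)}{q(t)}-\mathbb E_{q(t)}\left[\log\dfrac{\chi_a(t)}{q(t)}\right]\right).\end{cases}$$ Moreover, the vector field defining this system vanishes at $(\chi_a,q)$ if, and only if, $\chi_a=q$ and $\mathrm{Grad}f(q)=0$.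
   Context: $\Omega$ is a finite set with $N$ elements and $\mu$ is the uniform probability on $\Omega$. $\mathcal E(\mu)$ is the set of strictly positive probability densities with respect to $\mu$, i.e. functions $q:\Omega\to(0,\infty)$ with $\sum_{x}q(x)=N$. For $g:\Omega\to\mathbb R$, $\mathbb E_q[g]=\frac1N\sum_x g(x)q(x)$. For $q\in\mathcal E(\mu)$ the exponential fiber $S_q\mathcal E(\mu)$ and the mixture fiber ${}^*S_q\mathcal E(\mu)$ are both equal, as vector spaces, to $\{v:\Omega\to\mathbb R : \mathbb E_q[v]=0\}$, with duality pairing $\langle\eta,v\rangle_q=\mathbb E_q[\eta v]$. The statistical bundle is $\{(q,w):q\in\mathcal E(\mu),w\in S_q\mathcal E(\mu)\}$. The exponential transport is ${}^{e}\mathbb U_p^q v=v-\mathbb E_q[v]$ from $S_p\mathcal E(\mu)$ to $S_q\mathcal E(\mu)$. For $q\in\mathcal E(\mu)$ and $w\in S_q\mathcal E(\mu)$, $K_q(w)=\log\mathbb E_q[e^w]$ and $e_q(w)=e^{w-K_q(w)}\,q\in\mathcal E(\mu)$; $e_q:S_q\mathcal E(\mu)\to\mathcal E(\mu)$ is a bijection with inverse $r\mapsto\log\frac rq-\mathbb E_q[\log\frac rq]$. A dot denotes the ordinary time derivative. The velocity of a smooth curve $q(t)$ in $\mathcal E(\mu)$ is $\overset{\star}{q}(t)=\dot q(t)/q(t)\in S_{q(t)}\mathcal E(\mu)$. The mixture covariant derivative of $\eta(t)\in{}^*S_{q(t)}\mathcal E(\mu)$ along $q(t)$ is $\frac{D}{dt}\eta=\overset{\star}{q}\,\eta+\dot\eta$;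 this is the derivative used in the Euler–Lagrange equation. The natural gradient $\mathrm{Grad}f(q)\in{}^*S_q\mathcal E(\mu)$ is defined by $\frac{d}{dt}f(q(t))=\langle\mathrm{Grad}f(q(t)),\overset{\star}{q}(t)\rangle_{q(t)}$ for every smooth curve. Gradients of a Lagrangian $L(q,w)$: $\mathrm{Grad}_{e}L(q,w)\in{}^*S_q\mathcal E(\mu)$ is defined by $\frac{d}{ds}L(q,w+s\beta)|_{s=0}=\langle\mathrm{Grad}_{e}L(q,w),\beta\rangle_q$ for all $\beta\in S_q\mathcal E(\mu)$; $\mathrm{Grad}\,L(q,w)\in{}^*S_q\mathcal E(\mu)$ satisfies, for any $p\in\mathcal E(\mu)$, with $L_p(u,v)=L(e_p(u),{}^{e}\mathbb U_p^{e_p(u)}v)$, $q=e_p(u)$, $w={}^{e}\mathbb U_p^q v$: $\langle\mathrm{Grad}\,L(q,w),h\rangle_q=D_1L_p(u,v)[{}^{e}\mathbb U_q^p h]$ for all $h\in S_q\mathcal E(\mu)$, where $D_1$ is the differential in $u$. *)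

theory Defs
  imports "HOL-Analysis.Analysis"
begin

text \<open>
  The sample space \<open>\<Omega>\<close> is a finite type \<open>'n\<close>, so \<open>N = CARD('n)\<close>, and functions on \<open>\<Omega>\<close> are
  vectors \<open>real ^ 'n\<close>; sums and products of functions are taken pointwise.
\<close>

subsection \<open>Smooth maps on open sets\<close>

text \<open>
  On an open subset of a finite-dimensional space, \<open>f\<close> is of class \<open>C^(k+1)\<close> iff it is
  differentiable and all its directional derivatives are of class \<open>C^k\<close>.
\<close>

primrec Ck_on :: "nat \<Rightarrow> 'a::euclidean_space set \<Rightarrow> ('a \<Rightarrow> 'b::real_normed_vector) \<Rightarrow> bool" where
  "Ck_on 0 S f \<longleftrightarrow> continuous_on S f"
| "Ck_on (Suc k) S f \<longleftrightarrow>
     (\<forall>x\<in>S. f differentiable (at x)) \<and>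
     (\<forall>v. Ck_on k S (\<lambda>x. frechet_derivative f (at x) v))"

definition smooth_on :: "'a::euclidean_space set \<Rightarrow> ('a \<Rightarrow> 'b::real_normed_vector) \<Rightarrow> bool" where
  "smooth_on S f \<longleftrightarrow> (\<forall>k. Ck_on k S f)"

subsection \<open>The statistical bundle\<close>

definition densities :: "(real ^ 'n) set" where
  "densities = {q. (\<forall>x. 0 < q $ x) \<and> (\<Sum>x\<in>UNIV. q $ x) = real CARD('n)}"

definition expect :: "real ^ 'n \<Rightarrow> real ^ 'n \<Rightarrow> real" where
  "expect q g = (\<Sum>x\<in>UNIV. g $ x * q $ x) / real CARD('n)"

text \<open>The exponential and the mixture fiber at \<open>q\<close> coincide as vector spaces.\<close>

definition fiber :: "real ^ 'n \<Rightarrow> (real ^ 'n) set" where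
  "fiber q = {v. expect q v = 0}"

definition pairing :: "real ^ 'n \<Rightarrow> real ^ 'n \<Rightarrow> real ^ 'n \<Rightarrow> real" where
  "pairing q \<eta> v = expect q (\<chi> x. \<eta> $ x * v $ x)"

text \<open>The source \<open>p\<close> of the transport only determines its domain \<open>fiber p\<close>.\<close>

definition e_transport :: "real ^ 'n \<Rightarrow> real ^ 'n \<Rightarrow> real ^ 'n \<Rightarrow> real ^ 'n" where
  "e_transport p q v = (\<chi> x. v $ x - expect q v)"

definition cumulant :: "real ^ 'n \<Rightarrow> real ^ 'n \<Rightarrow> real" where
  "cumulant q w = ln (expect q (\<chi> x. exp (w $ x)))"

definition e_map :: "real ^ 'n \<Rightarrow> real ^ 'n \<Rightarrow> real ^ 'n" where
  "e_map q w = (\<chi> x. exp (w $ x - cumulant q w) * q $ x)"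

text \<open>
  A scalar field is smooth if it is smooth in every exponential chart, i.e. if \<open>f \<circ> e_map p\<close> is
  smooth on the vector space \<open>fiber p\<close>. As \<open>fiber p\<close> has no interior in \<open>real ^ 'n\<close>, this is
  expressed by precomposing with the linear projection \<open>u \<mapsto> u - E\<^sub>p[u]\<close> of \<open>real ^ 'n\<close> onto \<open>fiber p\<close>.
  Values of \<open>f\<close> outside \<open>densities\<close> are irrelevant.
\<close>

definition smooth_field :: "(real ^ 'n \<Rightarrow> real) \<Rightarrow> bool" where
  "smooth_field f \<longleftrightarrow>
     (\<forall>p\<in>densities. smooth_on UNIV (\<lambda>u. f (e_map p (\<chi> x. u $ x - expect p u))))"

definition smooth_curve :: "real set \<Rightarrow> (real \<Rightarrow> real ^ 'n) \<Rightarrow> bool" where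
  "smooth_curve I q \<longleftrightarrow>
     open I \<and> is_interval I \<and> (\<forall>t\<in>I. q t \<in> densities) \<and> smooth_on I q"

definition velocity :: "(real \<Rightarrow> real ^ 'n) \<Rightarrow> real \<Rightarrow> real ^ 'n" where
  "velocity q t = (\<chi> x. vector_derivative q (at t) $ x / q t $ x)"

definition mixture_deriv ::
  "(real \<Rightarrow> real ^ 'n) \<Rightarrow> (real \<Rightarrow> real ^ 'n) \<Rightarrow> real \<Rightarrow> real ^ 'n" where
  "mixture_deriv q \<eta> t =
     (\<chi> x. velocity q t $ x * \<eta> t $ x + vector_derivative \<eta> (at t) $ x)"

subsection \<open>Gradients\<close>

definition nat_grad :: "(real ^ 'n \<Rightarrow> real) \<Rightarrow> real ^ 'n \<Rightarrow> real ^ 'n" where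
  "nat_grad f q = (THE \<eta>. \<eta> \<in> fiber q \<and>
     (\<forall>I \<gamma>. \<forall>t\<in>I. smooth_curve I \<gamma> \<and> \<gamma> t = q \<longrightarrow>
        ((\<lambda>s. f (\<gamma> s)) has_real_derivative pairing q \<eta> (velocity \<gamma> t)) (at t)))"

definition grad_e :: "(real ^ 'n \<Rightarrow> real ^ 'n \<Rightarrow> real) \<Rightarrow> real ^ 'n \<Rightarrow> real ^ 'n \<Rightarrow> real ^ 'n" where
  "grad_e L q w = (THE \<eta>. \<eta> \<in> fiber q \<and>
     (\<forall>\<beta>\<in>fiber q. ((\<lambda>s. L q (w + s *\<^sub>R \<beta>)) has_real_derivative pairing q \<eta> \<beta>) (at 0)))"

definition in_chart ::
  "(real ^ 'n \<Rightarrow> real ^ 'n \<Rightarrow> real) \<Rightarrow> real ^ 'n \<Rightarrow> real ^ 'n \<Rightarrow> real ^ 'n \<Rightarrow> real" where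
  "in_chart L p u v = L (e_map p u) (e_transport p (e_map p u) v)"

text \<open>
  \<open>D\<close> is the differential at \<open>u\<close> of \<open>in_chart L p\<close> in its first argument, a map on \<open>fiber p\<close>; only
  the values of \<open>D\<close> on \<open>fiber p\<close> matter.
\<close>

definition grad :: "(real ^ 'n \<Rightarrow> real ^ 'n \<Rightarrow> real) \<Rightarrow> real ^ 'n \<Rightarrow> real ^ 'n \<Rightarrow> real ^ 'n" where
  "grad L q w = (THE \<eta>. \<eta> \<in> fiber q \<and>
     (\<forall>p\<in>densities. \<forall>u\<in>fiber p. \<forall>v\<in>fiber p.
        q = e_map p u \<and> w = e_transport p q v \<longrightarrow>
        (\<exists>D. ((\<lambda>u'. in_chart L p u' v) has_derivative D) (at u within fiber p) \<and>
             (\<forall>h\<in>fiber q. pairing q \<eta> h = D (e_transport q p h)))))"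

subsection \<open>The Euler--Lagrange equation and the first-order system\<close>

definition euler_lagrange ::
  "(real ^ 'n \<Rightarrow> real ^ 'n \<Rightarrow> real) \<Rightarrow> real set \<Rightarrow> (real \<Rightarrow> real ^ 'n) \<Rightarrow> bool" where
  "euler_lagrange L I q \<longleftrightarrow>
     (\<forall>t\<in>I. mixture_deriv q (\<lambda>s. grad_e L (q s) (velocity q s)) t = grad L (q t) (velocity q t))"

definition lagrangian ::
  "real \<Rightarrow> real \<Rightarrow> real \<Rightarrow> (real ^ 'n \<Rightarrow> real) \<Rightarrow> real ^ 'n \<Rightarrow> real ^ 'n \<Rightarrow> real" where
  "lagrangian a b c f q w = c * (inverse a * cumulant q (a *\<^sub>R w) - b * f q)"

definition system_field ::
  "real \<Rightarrow> real \<Rightarrow> (real ^ 'n \<Rightarrow> real) \<Rightarrow> (real ^ 'n) \<times> (real ^ 'n) \<Rightarrow> (real ^ 'n) \<times> (real ^ 'n)" where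
  "system_field a b f = (\<lambda>(X, q).
     (\<chi> x. inverse a * (X $ x - q $ x) - b * q $ x * nat_grad f q $ x,
      \<chi> x. inverse a * q $ x *
        (ln (X $ x / q $ x) - expect q (\<chi> y. ln (X $ y / q $ y)))))"

definition solves_system ::
  "real \<Rightarrow> real \<Rightarrow> (real ^ 'n \<Rightarrow> real) \<Rightarrow> real set \<Rightarrow>
   (real \<Rightarrow> real ^ 'n) \<Rightarrow> (real \<Rightarrow> real ^ 'n) \<Rightarrow> bool" where
  "solves_system a b f I X q \<longleftrightarrow>
     (\<forall>t\<in>I. ((\<lambda>s. (X s, q s)) has_vector_derivative system_field a b f (X t, q t)) (at t))"

end

theory Submission imports Defs begin

text \<open>
  Write \<open>\<chi> = e\<^sub>q(a w)\<close>, a density whose ratio to \<open>q\<close> is \<open>exp(a w) / E\<^sub>q[exp(a w)]\<close>. The proof rests on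
  two explicit gradients. The cumulant \<open>K\<^sub>q\<close> has differential \<open>h \<mapsto> E\<^sub>r[h]\<close> at \<open>w\<close>, where \<open>r = e\<^sub>q(w)\<close>
  (\<open>cumulant_has_derivative\<close>), so the fiber gradient of the Lagrangian is the momentum
  \<open>\<eta> = c (\<chi>/q - 1)\<close> (\<open>grad_e_lagrangian\<close>). In a chart \<open>q = e\<^sub>p(u)\<close> with \<open>w = v - E\<^sub>q[v]\<close>, one has
  \<open>K\<^sub>q(a w) = ln E\<^sub>q[exp(a v)] - a E\<^sub>q[v]\<close>; differentiating in \<open>q\<close> alone gives
  \<open>c (a\<inverse> (\<chi>/q - 1) - w - b Grad f)\<close> (\<open>grad_lagrangian\<close>), where the term \<open>-w\<close> comes from the
  dependence of the transport on \<open>q\<close>.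

  Along a curve with \<open>w = q'/q\<close>, the product rule gives the mixture derivative of the momentum as
  \<open>(q'/q) \<eta> + \<eta>' = c (\<chi>'/q - q'/q)\<close>. The term \<open>-q'/q\<close> cancels against \<open>-w\<close> on the other side of the
  Euler--Lagrange equation, and what remains, multiplied by \<open>q/c\<close>, is the equation for \<open>\<chi>'\<close>
  (\<open>euler_lagrange_pointwise\<close>). The equation for \<open>q'\<close> only says that \<open>a q'/q\<close> is the coordinate of
  \<open>\<chi>\<close> in the exponential chart at \<open>q\<close>, i.e. \<open>\<chi> = e\<^sub>q(a q'/q)\<close> (\<open>second_equation_pointwise\<close>).
  A zero of the vector field has zero chart coordinate, which forces \<open>\<chi> = q\<close> and then \<open>Grad f = 0\<close>.

  All gradients are defined by unique description. Existence comes from a Riesz representation for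
  the pairing (\<open>pairing_represents\<close>) and from the chain rule in charts; uniqueness comes from
  nondegeneracy (\<open>pairing_nondegenerate\<close>) once every fiber vector is seen to be a test direction,
  for instance the velocity of a mixture segment (\<open>mixture_segment\<close>).
\<close>

section \<open>Expectations and densities\<close>

lemma has_derivative_vec_iff:
  fixes f :: "'a::real_normed_vector \<Rightarrow> real ^ 'n"
  shows "(f has_derivative f') F \<longleftrightarrow> (\<forall>i. ((\<lambda>x. f x $ i) has_derivative (\<lambda>x. f' x $ i)) F)"
proof
  assume "(f has_derivative f') F"
  then show "\<forall>i. ((\<lambda>x. f x $ i) has_derivative (\<lambda>x. f' x $ i)) F"
    by (blast intro: bounded_linear.has_derivative[OF bounded_linear_vec_nth])
next
  assume *: "\<forall>i. ((\<lambda>x. f x $ i) has_derivative (\<lambda>x. f' x $ i)) F"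
  have "((\<lambda>x. \<Sum>i\<in>UNIV. f x $ i *\<^sub>R axis i 1) has_derivative
         (\<lambda>x. \<Sum>i\<in>UNIV. f' x $ i *\<^sub>R axis i (1::real))) F"
    by (intro has_derivative_sum has_derivative_scaleR_left *[rule_format])
  moreover have "(\<Sum>i\<in>UNIV. v $ i *\<^sub>R axis i (1::real)) = v" for v :: "real ^ 'n"
    using basis_expansion[of v] by (simp add: scalar_mult_eq_scaleR)
  ultimately show "(f has_derivative f') F" by simp
qed

lemma has_vector_derivative_vec_iff:
  fixes f :: "real \<Rightarrow> real ^ 'n"
  shows "(f has_vector_derivative f') F \<longleftrightarrow>
    (\<forall>i. ((\<lambda>t. f t $ i) has_real_derivative f' $ i) F)"
  unfolding has_vector_derivative_def has_derivative_vec_iff has_field_derivative_def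
  by (simp add: mult_commute_abs mult.commute)

lemma densities_pos: "q \<in> densities \<Longrightarrow> 0 < q $ x"
  and densities_sum: "q \<in> densities \<Longrightarrow> (\<Sum>x\<in>UNIV. q $ x) = real CARD('n)"
  for q :: "real ^ 'n"
  by (auto simp: densities_def)

lemma densities_nz: "q \<in> densities \<Longrightarrow> q $ x \<noteq> 0"
  using densities_pos[of q x] by simp

lemma expect_diff: "expect q (\<chi> x. g x - h x) = expect q (\<chi> x. g x) - expect q (\<chi> x. h x)"
  and expect_cmul: "expect q (\<chi> x. r * g x) = r * expect q (\<chi> x. g x)"
  by (simp_all add: expect_def sum_subtractf sum_distrib_left algebra_simps
      diff_divide_distrib)

lemma expect_const: "q \<in> densities \<Longrightarrow> expect q (\<chi> x. r) = r"
  by (simp add: expect_def densities_sum flip: sum_distrib_left)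

lemma bounded_linear_expect:
  fixes q :: "real ^ 'n"
  shows "bounded_linear (expect q)"
proof -
  have "expect q = (\<lambda>g. \<Sum>x\<in>UNIV. g $ x * (q $ x / real CARD('n)))"
    by (simp add: expect_def sum_divide_distrib fun_eq_iff)
  then show ?thesis
    by (simp only:) (intro bounded_linear_sum bounded_linear_compose[OF bounded_linear_mult_left]
        bounded_linear_vec_nth)
qed

lemma expect_pos:
  assumes "q \<in> densities" "\<And>x. 0 < g $ x"
  shows "0 < expect q g"
  unfolding expect_def using assms by (intro divide_pos_pos sum_pos) (auto simp: densities_pos)

lemma expect_exp_pos: "q \<in> densities \<Longrightarrow> 0 < expect q (\<chi> x. exp (w x))"
  by (rule expect_pos) auto

lemma centred_in_fiber: "q \<in> densities \<Longrightarrow> e_transport p q v \<in> fiber q"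
  by (simp add: fiber_def e_transport_def expect_diff expect_const)

lemma e_transport_fiber: "v \<in> fiber q \<Longrightarrow> e_transport p q v = v"
  by (simp add: fiber_def e_transport_def vec_eq_iff)

lemma pairing_diff_left: "pairing q \<eta> v - pairing q \<eta>' v = expect q (\<chi> x. (\<eta> $ x - \<eta>' $ x) * v $ x)"
  by (simp add: pairing_def left_diff_distrib expect_diff)

text \<open>
  Testing with \<open>h = \<eta> - \<eta>'\<close> gives \<open>E\<^sub>q[(\<eta> - \<eta>')\<^sup>2] = 0\<close>, and \<open>q\<close> is strictly positive.
\<close>

lemma pairing_nondegenerate:
  assumes q: "q \<in> densities" and "\<eta> \<in> fiber q" "\<eta>' \<in> fiber q"
    and eq: "\<And>h. h \<in> fiber q \<Longrightarrow> pairing q \<eta> h = pairing q \<eta>' h"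
  shows "\<eta> = \<eta>'"
proof -
  have fib: "(\<chi> x. \<eta> $ x - \<eta>' $ x) \<in> fiber q"
    using assms(2,3) by (simp add: fiber_def expect_diff)
  have "expect q (\<chi> x. (\<eta> $ x - \<eta>' $ x) * (\<eta> $ x - \<eta>' $ x)) = 0"
    using eq[OF fib] pairing_diff_left[of q \<eta> "\<chi> x. \<eta> $ x - \<eta>' $ x" \<eta>'] by simp
  then have "(\<Sum>x\<in>UNIV. (\<eta> $ x - \<eta>' $ x) * (\<eta> $ x - \<eta>' $ x) * q $ x) = 0"
    by (simp add: expect_def)
  then have "\<forall>x. (\<eta> $ x - \<eta>' $ x) * (\<eta> $ x - \<eta>' $ x) * q $ x = 0"
    using q by (subst (asm) sum_nonneg_eq_0_iff)
      (auto intro!: mult_nonneg_nonneg[OF zero_le_square less_imp_le[OF densities_pos]])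
  then show ?thesis using densities_nz[OF q] by (auto simp: vec_eq_iff)
qed

text \<open>
  Riesz representation: dividing the coordinates of \<open>D\<close> by the weights \<open>q x / N\<close> gives a vector that
  represents \<open>D\<close> everywhere, and centring it does not change its pairing with the fiber.
\<close>

lemma pairing_represents:
  fixes q :: "real ^ 'n"
  assumes q: "q \<in> densities" and D: "linear D"
  shows "\<exists>\<eta>\<in>fiber q. \<forall>h\<in>fiber q. pairing q \<eta> h = D h"
proof -
  define \<zeta> :: "real ^ 'n" where "\<zeta> = (\<chi> x. real CARD('n) * D (axis x 1) / q $ x)"
  have D_eq: "D h = pairing q \<zeta> h" for h
  proof -
    have "D h = D (\<Sum>x\<in>UNIV. h $ x *\<^sub>R axis x 1)"
      using basis_expansion[of h] by (simp add: scalar_mult_eq_scaleR)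
    also have "\<dots> = (\<Sum>x\<in>UNIV. h $ x * D (axis x 1))"
      by (simp add: linear_sum[OF D] linear_cmul[OF D])
    also have "\<dots> = pairing q \<zeta> h"
      by (simp add: pairing_def expect_def \<zeta>_def densities_nz[OF q] sum_divide_distrib algebra_simps)
    finally show ?thesis .
  qed
  have "pairing q (e_transport q q \<zeta>) h = D h" if "h \<in> fiber q" for h
    using that unfolding D_eq
    by (simp add: pairing_def e_transport_def left_diff_distrib expect_diff expect_cmul fiber_def)
  then show ?thesis using centred_in_fiber[OF q] by blast
qed

lemma pairing_density_ratio:
  "q \<in> densities \<Longrightarrow> pairing q (\<chi> x. X $ x / q $ x) h = expect X h"
  by (simp add: pairing_def expect_def densities_nz mult_ac)

lemma density_ratio_in_fiber:
  assumes "q \<in> densities" "X \<in> densities"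
  shows "(\<chi> x. r * (X $ x / q $ x - 1)) \<in> fiber q"
  using assms expect_const[OF assms(2), of 1] pairing_density_ratio[OF assms(1), of X "\<chi> x. 1"]
  by (simp add: fiber_def expect_cmul expect_diff expect_const pairing_def)

section \<open>Exponential charts\<close>

lemma e_map_nth:
  assumes "q \<in> densities"
  shows "e_map q w $ x = exp (w $ x) * q $ x / expect q (\<chi> y. exp (w $ y))"
  by (simp add: e_map_def cumulant_def exp_diff expect_exp_pos[OF assms])

lemma expect_e_map:
  assumes "q \<in> densities"
  shows "expect (e_map q w) g = expect q (\<chi> x. exp (w $ x) * g $ x) / expect q (\<chi> x. exp (w $ x))"
  unfolding expect_def[of _ g] expect_def[of q "\<chi> x. exp (w $ x) * g $ x"]
  by (simp add: e_map_nth[OF assms] sum_divide_distrib mult_ac)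

lemma e_map_densities:
  fixes q :: "real ^ 'n"
  assumes q: "q \<in> densities"
  shows "e_map q w \<in> densities"
proof -
  have "expect (e_map q w) (\<chi> x. 1) = 1"
    using expect_exp_pos[OF q, of "\<lambda>x. w $ x"] by (simp add: expect_e_map[OF q])
  moreover have "0 < e_map q w $ x" for x
    using densities_pos[OF q] by (simp add: e_map_def)
  ultimately show ?thesis
    by (simp add: densities_def expect_def)
qed

text \<open>
  Normalisation absorbs additive constants, so the chart coordinate of \<open>r\<close> at \<open>q\<close> may be taken to be
  \<open>ln (r/q)\<close> up to an arbitrary constant \<open>m\<close>. This freedom is used throughout to avoid projecting onto
  fibers.
\<close>

lemma e_map_eqI:
  assumes q: "q \<in> densities" and r: "r \<in> densities"
    and "\<And>x. w $ x = ln (r $ x / q $ x) + m"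
  shows "e_map q w = r"
proof -
  have *: "exp (w $ x) * q $ x = exp m * r $ x" for x
    using densities_pos[OF q, of x] densities_pos[OF r, of x]
    by (simp add: assms(3) exp_add)
  then have "expect q (\<chi> x. exp (w $ x)) = expect r (\<chi> x. exp m)"
    unfolding expect_def by simp
  then show ?thesis
    by (simp add: vec_eq_iff e_map_nth[OF q] * expect_const[OF r])
qed

lemma e_map_shift:
  assumes q: "q \<in> densities"
  shows "e_map q (\<chi> x. w $ x + m) = e_map q w"
  using densities_nz[OF q]
  by (intro e_map_eqI[OF q e_map_densities[OF q], where m = "m + cumulant q w"]) (simp add: e_map_def)

lemma e_map_zero: "q \<in> densities \<Longrightarrow> e_map q 0 = q"
  by (rule e_map_eqI[of q q _ 0]) (simp_all add: densities_nz)

lemma ln_e_map_ratio: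
  assumes q: "q \<in> densities"
  shows "ln (e_map q w $ x / q $ x) = w $ x - cumulant q w"
  by (simp add: e_map_def densities_nz[OF q])

lemma cumulant_has_derivative:
  assumes q: "q \<in> densities"
  shows "(cumulant q has_derivative expect (e_map q w)) (at w)"
proof -
  have "((\<lambda>w. (\<chi> x. exp (w $ x))) has_derivative (\<lambda>h. (\<chi> x. exp (w $ x) * h $ x))) (at w)"
    unfolding has_derivative_vec_iff
    by (auto intro!: derivative_eq_intros bounded_linear.has_derivative[OF bounded_linear_vec_nth])
  from bounded_linear.has_derivative[OF bounded_linear_expect this]
  have "((\<lambda>w. expect q (\<chi> x. exp (w $ x))) has_derivative
     (\<lambda>h. expect q (\<chi> x. exp (w $ x) * h $ x))) (at w)" .
  from has_derivative_ln[OF _ this] expect_exp_pos[OF q, of "\<lambda>x. w $ x"]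
  show ?thesis
    unfolding cumulant_def[abs_def] expect_e_map[OF q] by (simp add: divide_inverse mult.commute expect_e_map[OF q])
qed

text \<open>
  Moving along an exponential family differentiates an expectation into a covariance: the quotient
  rule applied to \<open>E\<^sub>p[exp(u) g] / E\<^sub>p[exp u]\<close>.
\<close>

lemma expect_e_map_has_derivative:
  assumes p: "p \<in> densities" and q: "q = e_map p u"
  shows "((\<lambda>u. expect (e_map p u) g) has_derivative
    (\<lambda>k. expect q (\<chi> x. g $ x * k $ x) - expect q g * expect q k)) (at u)"
proof -
  let ?Z = "expect p (\<chi> x. exp (u $ x))"
  have "((\<lambda>w. (\<chi> x. exp (w $ x) * g $ x)) has_derivative (\<lambda>h. (\<chi> x. exp (u $ x) * (g $ x * h $ x)))) (at u)"
    for g :: "real ^ 'a"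
    unfolding has_derivative_vec_iff
    by (auto intro!: derivative_eq_intros bounded_linear.has_derivative[OF bounded_linear_vec_nth])
  from bounded_linear.has_derivative[OF bounded_linear_expect this]
  have d: "((\<lambda>u. expect p (\<chi> x. exp (u $ x) * g $ x)) has_derivative
     (\<lambda>h. expect p (\<chi> x. exp (u $ x) * (g $ x * h $ x)))) (at u)" for g .
  have Z: "?Z \<noteq> 0" using expect_exp_pos[OF p, of "\<lambda>x. u $ x"] by simp
  have d1: "((\<lambda>u. expect p (\<chi> x. exp (u $ x))) has_derivative
     (\<lambda>h. expect p (\<chi> x. exp (u $ x) * h $ x))) (at u)"
    using d[of "\<chi> x. 1"] by simp
  show ?thesis
    unfolding expect_e_map[OF p] q
    by (rule has_derivative_eq_rhs[OF has_derivative_divide'[OF d d1 Z]])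
       (use Z in \<open>auto simp: fun_eq_iff field_simps\<close>)
qed

section \<open>Smooth curves and the natural gradient\<close>

text \<open>
  The projection in the definition of a smooth field shifts the argument by a constant, which
  \<open>e_map\<close> ignores; hence the chart expression is differentiable on the whole space.
\<close>

lemma smooth_field_chart:
  assumes "smooth_field f" "p \<in> densities"
  obtains D where "((\<lambda>u. f (e_map p u)) has_derivative D) (at u)"
proof -
  have "Ck_on (Suc 0) UNIV (\<lambda>u. f (e_map p (\<chi> x. u $ x - expect p u)))"
    using assms unfolding smooth_field_def smooth_on_def by blast
  moreover have "e_map p (\<chi> x. u $ x - expect p u) = e_map p u" for u
    using e_map_shift[OF assms(2), of u "- expect p u"] by simp
  ultimately have "(\<lambda>u. f (e_map p u)) differentiable (at u)" by auto
  then show ?thesis using that by (auto simp: differentiable_def)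
qed

lemma smooth_curve_vector_derivative:
  assumes "smooth_curve I q" "t \<in> I"
  shows "(q has_vector_derivative vector_derivative q (at t)) (at t)"
    and "\<exists>w. ((\<lambda>s. vector_derivative q (at s)) has_vector_derivative w) (at t)"
proof -
  have I: "open I" and "Ck_on (Suc (Suc 0)) I q"
    using assms(1) by (auto simp: smooth_curve_def smooth_on_def simp del: Ck_on.simps)
  then have d: "\<And>s. s \<in> I \<Longrightarrow> q differentiable (at s)"
    and "(\<lambda>s. frechet_derivative q (at s) 1) differentiable (at t)"
    using assms(2) by auto
  then obtain w where w: "((\<lambda>s. frechet_derivative q (at s) 1) has_vector_derivative w) (at t)"
    using vector_derivative_works by blast
  have "((\<lambda>s. vector_derivative q (at s)) has_vector_derivative w) (at t)"
    by (rule has_vector_derivative_transform_within_open[OF w I assms(2)])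
       (simp add: frechet_derivative_eq_vector_derivative d)
  then show "\<exists>w. ((\<lambda>s. vector_derivative q (at s)) has_vector_derivative w) (at t)" ..
  show "(q has_vector_derivative vector_derivative q (at t)) (at t)"
    using d assms(2) vector_derivative_works by blast
qed

lemma smooth_curve_densities: "smooth_curve I q \<Longrightarrow> t \<in> I \<Longrightarrow> q t \<in> densities"
  and smooth_curve_open: "smooth_curve I q \<Longrightarrow> open I"
  by (auto simp: smooth_curve_def)

text \<open>
  Total mass is conserved along the curve. With the vector \<open>1\<close> as weight, \<open>expect\<close> is this total mass
  divided by \<open>N\<close>, as a linear function of the density.
\<close>

lemma velocity_in_fiber:
  fixes q :: "real \<Rightarrow> real ^ 'n"
  assumes "smooth_curve I q" "t \<in> I"
  shows "velocity q t \<in> fiber (q t)"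
proof -
  have *: "((\<lambda>s. expect (\<chi> x. 1) (q s)) has_vector_derivative
      expect (\<chi> x. 1) (vector_derivative q (at t))) (at t)"
    by (rule bounded_linear.has_vector_derivative[OF bounded_linear_expect])
       (rule smooth_curve_vector_derivative(1)[OF assms])
  have "expect (\<chi> x. 1) (q s) = 1" if "s \<in> I" for s
    using smooth_curve_densities[OF assms(1) that] by (simp add: expect_def densities_sum)
  then have "((\<lambda>s. 1) has_vector_derivative
      expect (\<chi> x. 1) (vector_derivative q (at t))) (at t)"
    by (rule has_vector_derivative_transform_within_open[OF * smooth_curve_open[OF assms(1)] assms(2)])
  then have "expect (\<chi> x. 1) (vector_derivative q (at t)) = 0"
    by (rule vector_derivative_unique_at[OF _ has_vector_derivative_const])
  then show ?thesis
    using densities_nz[OF smooth_curve_densities[OF assms]] by (simp add: fiber_def expect_def velocity_def)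
qed

lemma Ck_on_affine: "Ck_on k S (\<lambda>s::real. u + s *\<^sub>R (v::'b::real_normed_vector))"
proof -
  have const: "Ck_on k S (\<lambda>s::real. w)" for k and w :: 'b
    by (induction k arbitrary: w) auto
  have "((\<lambda>s::real. u + s *\<^sub>R v) has_derivative (\<lambda>h. h *\<^sub>R v)) (at s)" for s
    by (auto intro!: derivative_eq_intros)
  from frechet_derivative_at[OF this]
  have "frechet_derivative (\<lambda>s::real. u + s *\<^sub>R v) (at s) h = h *\<^sub>R v" for s h
    by metis
  then show ?thesis
    by (cases k) (auto intro!: continuous_intros const)
qed

text \<open>
  The segment \<open>s \<mapsto> q (1 + s h)\<close> realises any fiber vector \<open>h\<close> as a velocity. It is affine, so its
  smoothness is immediate, in contrast to the exponential curve with the same velocity.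
\<close>

lemma mixture_segment:
  fixes q :: "real ^ 'n"
  assumes q: "q \<in> densities" and h: "h \<in> fiber q"
  obtains I \<gamma> where "smooth_curve I \<gamma>" "0 \<in> I" "\<gamma> 0 = q" "velocity \<gamma> 0 = h"
proof -
  define v where "v = (\<chi> x. h $ x * q $ x)"
  define \<gamma> where "\<gamma> s = q + s *\<^sub>R v" for s
  \<comment> \<open>for \<open>\<bar>s\<bar> < e\<close> one has \<open>\<bar>s h x\<bar> < 1\<close>, which keeps the segment positive\<close>
  define e where "e = 1 / (1 + norm h)"
  have n: "0 < 1 + norm h" by (simp add: add_pos_nonneg)
  then have e: "0 < e" by (simp add: e_def)
  have "\<gamma> s \<in> densities" if s: "s \<in> {-e<..<e}" for s
  proof -
    have "(\<Sum>x\<in>UNIV. v $ x) = 0"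
      using h by (simp add: fiber_def expect_def v_def)
    then have "(\<Sum>x\<in>UNIV. \<gamma> s $ x) = real CARD('n)"
      by (simp add: \<gamma>_def sum.distrib densities_sum[OF q] flip: sum_distrib_left)
    moreover have "0 < \<gamma> s $ x" for x
    proof -
      have "\<bar>s * h $ x\<bar> \<le> \<bar>s\<bar> * norm h"
        unfolding abs_mult by (intro mult_left_mono component_le_norm_cart) auto
      also have "\<dots> \<le> \<bar>s\<bar> * (1 + norm h)" by (simp add: mult_left_mono)
      also have "\<dots> < e * (1 + norm h)"
        using s by (intro mult_strict_right_mono) (auto simp: add_pos_nonneg)
      also have "\<dots> = 1" using n by (simp add: e_def less_imp_neq[symmetric])
      finally have "0 < 1 + s * h $ x" by linarith
      then have "0 < (1 + s * h $ x) * q $ x" using densities_pos[OF q] by simp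
      then show ?thesis by (simp add: \<gamma>_def v_def algebra_simps)
    qed
    ultimately show ?thesis by (simp add: densities_def)
  qed
  then have "smooth_curve {-e<..<e} \<gamma>"
    by (auto simp: smooth_curve_def smooth_on_def is_interval_oo \<gamma>_def[abs_def] Ck_on_affine)
  moreover have "(\<gamma> has_vector_derivative v) (at 0)"
    unfolding \<gamma>_def by (auto intro!: derivative_eq_intros)
  then have "velocity \<gamma> 0 = h"
    using densities_nz[OF q] by (simp add: velocity_def vector_derivative_at vec_eq_iff v_def \<gamma>_def)
  ultimately show ?thesis using that[of "{-e<..<e}" \<gamma>] e by (simp add: \<gamma>_def)
qed

text \<open>
  Chain rule for \<open>f \<circ> e\<^sub>p\<close> along the coordinate lift of \<open>\<gamma>\<close>. The lift is only determined up to an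
  additive constant depending on time; letting this constant grow with slope \<open>m\<close> shows that \<open>D\<close> does
  not see constants. Both \<open>m = 0\<close> and the value of \<open>m\<close> that transports a vector from the fiber at
  \<open>e\<^sub>p(u)\<close> to the fiber at \<open>p\<close> are needed later.
\<close>

lemma chart_derivative_along_curve:
  assumes p: "p \<in> densities"
    and D: "((\<lambda>u. f (e_map p u)) has_derivative D) (at u)"
    and \<gamma>: "smooth_curve I \<gamma>" "t \<in> I" "\<gamma> t = e_map p u"
  shows "((\<lambda>s. f (\<gamma> s)) has_real_derivative D (\<chi> x. velocity \<gamma> t $ x + m)) (at t)"
proof -
  \<comment> \<open>the lift of \<open>\<gamma>\<close> through \<open>e_map p\<close>, normalised to pass through \<open>u\<close> at time \<open>t\<close>\<close>
  define U where "U s = (\<chi> x. ln (\<gamma> s $ x / p $ x) + (cumulant p u + m * (s - t)))" for s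
  have Ut: "U t = u"
    by (simp add: U_def \<gamma>(3) ln_e_map_ratio[OF p])
  have "((\<lambda>s. \<gamma> s $ x) has_real_derivative vector_derivative \<gamma> (at t) $ x) (at t)" for x
    using smooth_curve_vector_derivative(1)[OF \<gamma>(1,2)] by (simp add: has_vector_derivative_vec_iff)
  then have "(U has_vector_derivative (\<chi> x. velocity \<gamma> t $ x + m)) (at t)"
    unfolding has_vector_derivative_vec_iff U_def velocity_def
    using densities_pos[OF p] densities_pos[OF smooth_curve_densities[OF \<gamma>(1,2)]]
    by (auto intro!: derivative_eq_intros simp: field_simps less_imp_neq[symmetric])
  moreover have "((\<lambda>u. f (e_map p u)) has_derivative D) (at (U t))"
    using D by (simp add: Ut)
  ultimately have "((\<lambda>s. f (e_map p (U s))) has_derivative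
      (\<lambda>r. D (r *\<^sub>R (\<chi> x. velocity \<gamma> t $ x + m)))) (at t)"
    unfolding has_vector_derivative_def by (rule has_derivative_compose)
  then have *: "((\<lambda>s. f (e_map p (U s))) has_real_derivative D (\<chi> x. velocity \<gamma> t $ x + m)) (at t)"
    by (simp add: has_field_derivative_def linear_cmul[OF has_derivative_linear[OF D]] mult.commute[of _ "D _"])
  moreover have "e_map p (U s) = \<gamma> s" if "s \<in> I" for s
    by (rule e_map_eqI[OF p smooth_curve_densities[OF \<gamma>(1) that]]) (simp add: U_def)
  ultimately show ?thesis
    by (intro has_field_derivative_transform_within_open[OF * smooth_curve_open[OF \<gamma>(1)] \<gamma>(2)]) simp
qed

text \<open>
  Existence follows from the chart centred at \<open>q\<close> and uniqueness from mixture segments. The second part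
  computes the differential of \<open>f\<close> in an arbitrary chart, again by testing on a mixture segment.
\<close>

lemma nat_grad_chart:
  assumes f: "smooth_field f" and q: "q \<in> densities"
  shows "nat_grad f q \<in> fiber q"
    and "\<lbrakk>p \<in> densities; q = e_map p u; ((\<lambda>u. f (e_map p u)) has_derivative D) (at u); h \<in> fiber q\<rbrakk>
      \<Longrightarrow> D (\<chi> x. h $ x + m) = pairing q (nat_grad f q) h"
proof -
  let ?P = "\<lambda>\<eta>. \<eta> \<in> fiber q \<and>
     (\<forall>I \<gamma>. \<forall>t\<in>I. smooth_curve I \<gamma> \<and> \<gamma> t = q \<longrightarrow>
        ((\<lambda>s. f (\<gamma> s)) has_real_derivative pairing q \<eta> (velocity \<gamma> t)) (at t))"
  have e0: "e_map q 0 = q" by (rule e_map_zero[OF q])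
  obtain D0 where D0: "((\<lambda>u. f (e_map q u)) has_derivative D0) (at 0)"
    using smooth_field_chart[OF f q] .
  obtain \<eta> where \<eta>: "\<eta> \<in> fiber q" "\<And>h. h \<in> fiber q \<Longrightarrow> pairing q \<eta> h = D0 h"
    using pairing_represents[OF q has_derivative_linear[OF D0]] by blast
  have P\<eta>: "?P \<eta>"
  proof (intro conjI allI ballI impI \<eta>)
    fix I \<gamma> t assume *: "t \<in> I" "smooth_curve I \<gamma> \<and> \<gamma> t = q"
    then show "((\<lambda>s. f (\<gamma> s)) has_real_derivative pairing q \<eta> (velocity \<gamma> t)) (at t)"
      using chart_derivative_along_curve[OF q D0, of I \<gamma> t 0] velocity_in_fiber[of I \<gamma> t] \<eta>(2)
      by (auto simp: e0)
  qed
  have uniq: "\<eta>' = \<eta>''" if P: "?P \<eta>'" "?P \<eta>''" for \<eta>' \<eta>''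
  proof (rule pairing_nondegenerate[OF q])
    fix h assume "h \<in> fiber q"
    then obtain I \<gamma> where \<gamma>: "smooth_curve I \<gamma>" "0 \<in> I" "\<gamma> 0 = q" "velocity \<gamma> 0 = h"
      using mixture_segment[OF q] by blast
    show "pairing q \<eta>' h = pairing q \<eta>'' h"
      using P[THEN conjunct2, rule_format, OF \<gamma>(2) conjI[OF \<gamma>(1,3)]] unfolding \<gamma>(4)
      by (rule DERIV_unique)
  qed (use P in blast)+
  have P: "?P (nat_grad f q)"
    unfolding nat_grad_def by (rule theI'[of ?P], rule ex1I[of ?P, OF P\<eta>], rule uniq[OF _ P\<eta>])
  then show "nat_grad f q \<in> fiber q" by blast
  show "D (\<chi> x. h $ x + m) = pairing q (nat_grad f q) h"
    if p: "p \<in> densities" "q = e_map p u" and D: "((\<lambda>u. f (e_map p u)) has_derivative D) (at u)"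
      and h: "h \<in> fiber q"
  proof -
    obtain I \<gamma> where \<gamma>: "smooth_curve I \<gamma>" "0 \<in> I" "\<gamma> 0 = q" "velocity \<gamma> 0 = h"
      using mixture_segment[OF q h] .
    have "((\<lambda>s. f (\<gamma> s)) has_real_derivative D (\<chi> x. h $ x + m)) (at 0)"
      using chart_derivative_along_curve[OF p(1) D \<gamma>(1,2)] \<gamma>(3,4) p(2) by simp
    moreover have "((\<lambda>s. f (\<gamma> s)) has_real_derivative pairing q (nat_grad f q) h) (at 0)"
      using P[THEN conjunct2, rule_format, OF \<gamma>(2) conjI[OF \<gamma>(1,3)]] unfolding \<gamma>(4) .
    ultimately show ?thesis by (rule DERIV_unique)
  qed
qed

section \<open>Gradients of the Lagrangian\<close>

text \<open>
  Only the cumulant depends on \<open>w\<close>; its differential at \<open>a w\<close> is expectation under \<open>\<chi>\<close>, and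
  this is the pairing with \<open>\<chi>/q\<close>. Subtracting \<open>1\<close> puts the representative in the fiber.
\<close>

lemma grad_e_lagrangian:
  assumes q: "q \<in> densities" and a: "a > 0"
  shows "grad_e (lagrangian a b c f) q w = (\<chi> x. c * (e_map q (a *\<^sub>R w) $ x / q $ x - 1))"
proof -
  define X where "X = e_map q (a *\<^sub>R w)"
  define \<eta> where "\<eta> = (\<chi> x. c * (X $ x / q $ x - 1))"
  let ?L = "lagrangian a b c f"
  have X: "X \<in> densities" by (simp add: X_def e_map_densities q)
  have \<eta>: "\<eta> \<in> fiber q" unfolding \<eta>_def by (rule density_ratio_in_fiber[OF q X])
  have p: "pairing q \<eta> \<beta> = c * expect X \<beta>" if "\<beta> \<in> fiber q" for \<beta>
    using that pairing_density_ratio[OF q, of X \<beta>]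
    by (simp add: \<eta>_def pairing_def expect_cmul expect_diff fiber_def left_diff_distrib mult.assoc)
  have d: "((\<lambda>s. ?L q (w + s *\<^sub>R \<beta>)) has_real_derivative c * expect X \<beta>) (at 0)" for \<beta>
  proof -
    have "((\<lambda>s. a *\<^sub>R (w + s *\<^sub>R \<beta>)) has_derivative (\<lambda>s. a *\<^sub>R (s *\<^sub>R \<beta>))) (at 0)"
      by (auto intro!: derivative_eq_intros)
    moreover have "(cumulant q has_derivative expect X) (at (a *\<^sub>R (w + 0 *\<^sub>R \<beta>)))"
      using cumulant_has_derivative[OF q] by (simp add: X_def)
    ultimately have "((\<lambda>s. cumulant q (a *\<^sub>R (w + s *\<^sub>R \<beta>))) has_derivative
        (\<lambda>s. expect X (a *\<^sub>R (s *\<^sub>R \<beta>)))) (at 0)"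
      by (rule has_derivative_compose)
    then have "((\<lambda>s. cumulant q (a *\<^sub>R (w + s *\<^sub>R \<beta>))) has_real_derivative a * expect X \<beta>) (at 0)"
      unfolding has_field_derivative_def
      by (rule has_derivative_eq_rhs)
         (simp add: fun_eq_iff linear_cmul[OF bounded_linear.linear[OF bounded_linear_expect]])
    then show ?thesis
      unfolding lagrangian_def using a by (auto intro!: derivative_eq_intros)
  qed
  have "grad_e ?L q w = \<eta>"
    unfolding grad_e_def
  proof (rule the_equality)
    show "\<eta> \<in> fiber q \<and>
      (\<forall>\<beta>\<in>fiber q. ((\<lambda>s. ?L q (w + s *\<^sub>R \<beta>)) has_real_derivative pairing q \<eta> \<beta>) (at 0))"
      using \<eta> d p by simp
  next
    fix \<eta>'
    assume *: "\<eta>' \<in> fiber q \<and>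
      (\<forall>\<beta>\<in>fiber q. ((\<lambda>s. ?L q (w + s *\<^sub>R \<beta>)) has_real_derivative pairing q \<eta>' \<beta>) (at 0))"
    show "\<eta>' = \<eta>"
    proof (rule pairing_nondegenerate[OF q _ \<eta>])
      fix \<beta> assume "\<beta> \<in> fiber q"
      then show "pairing q \<eta>' \<beta> = pairing q \<eta> \<beta>"
        using * d p DERIV_unique by metis
    qed (use * in blast)
  qed
  then show ?thesis by (simp add: \<eta>_def X_def)
qed

text \<open>
  The transport subtracts \<open>E\<^sub>q[v]\<close> from \<open>v\<close>, which leaves the cumulant as an additive constant.
\<close>

lemma in_chart_lagrangian:
  assumes p: "p \<in> densities"
  shows "in_chart (lagrangian a b c f) p u v =
    c * (inverse a * (ln (expect (e_map p u) (\<chi> x. exp (a * v $ x))) - a * expect (e_map p u) v)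
      - b * f (e_map p u))"
proof -
  let ?q = "e_map p u"
  have q: "?q \<in> densities" by (rule e_map_densities[OF p])
  have "(\<chi> x. exp (a * (v $ x - expect ?q v))) = (\<chi> x. exp (- (a * expect ?q v)) * exp (a * v $ x))"
    by (simp add: vec_eq_iff algebra_simps flip: exp_add)
  then have "cumulant ?q (a *\<^sub>R e_transport p ?q v) =
      ln (exp (- (a * expect ?q v)) * expect ?q (\<chi> x. exp (a * v $ x)))"
    by (simp add: cumulant_def e_transport_def expect_cmul)
  also have "\<dots> = ln (expect ?q (\<chi> x. exp (a * v $ x))) - a * expect ?q v"
    using expect_exp_pos[OF q, of "\<lambda>x. a * v $ x"] by (simp add: ln_mult)
  finally show ?thesis by (simp add: in_chart_def lagrangian_def)
qed

text \<open>
  By \<open>expect_e_map_has_derivative\<close> the differential consists of covariances under \<open>q\<close>. Against a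
  vector \<open>h\<close> centred at \<open>q\<close>, each covariance with the transported \<open>h - E\<^sub>p[h]\<close> reduces to a plain
  expectation of the product with \<open>h\<close>.
\<close>

lemma in_chart_lagrangian_has_derivative:
  assumes f: "smooth_field f" and a: "a > 0" and p: "p \<in> densities"
    and q: "q = e_map p u" and w: "w = e_transport p q v"
  shows "\<exists>D. ((\<lambda>u'. in_chart (lagrangian a b c f) p u' v) has_derivative D) (at u) \<and>
    (\<forall>h\<in>fiber q. D (e_transport q p h) =
       pairing q (\<chi> x. c * (inverse a * (e_map q (a *\<^sub>R w) $ x / q $ x - 1)
         - w $ x - b * nat_grad f q $ x)) h)"
proof -
  have qd: "q \<in> densities" by (simp add: q e_map_densities[OF p])
  let ?g = "\<chi> x. exp (a * v $ x)"
  let ?X = "e_map q (a *\<^sub>R w)"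
  have g: "0 < expect q ?g" by (rule expect_exp_pos[OF qd])
  obtain F where F: "((\<lambda>u. f (e_map p u)) has_derivative F) (at u)"
    using smooth_field_chart[OF f p] .
  \<comment> \<open>covariance under \<open>q\<close>\<close>
  let ?C = "\<lambda>g k. expect q (\<chi> x. g $ x * k $ x) - expect q g * expect q k"
  let ?D = "\<lambda>k. c * (inverse a * (?C ?g k / expect q ?g - a * ?C v k) - b * F k)"
  note E = expect_e_map_has_derivative[OF p q]
  have "((\<lambda>u'. in_chart (lagrangian a b c f) p u' v) has_derivative ?D) (at u)"
    unfolding in_chart_lagrangian[OF p]
    using g by (auto intro!: derivative_eq_intros E F simp: q divide_inverse)
  moreover have "?D (e_transport q p h) =
       pairing q (\<chi> x. c * (inverse a * (?X $ x / q $ x - 1)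
         - w $ x - b * nat_grad f q $ x)) h" if h: "h \<in> fiber q" for h
  proof -
    have k: "e_transport q p h = (\<chi> x. h $ x + - expect p h)" by (simp add: e_transport_def)
    have C: "?C g (e_transport q p h) = expect q (\<chi> x. g $ x * h $ x)" for g
      using h by (simp add: e_transport_def right_diff_distrib expect_diff expect_const[OF qd] fiber_def
          mult.commute[of _ "expect p h"] expect_cmul)
    have Fk: "F (e_transport q p h) = pairing q (nat_grad f q) h"
      unfolding k by (rule nat_grad_chart(2)[OF f qd p q F h])
    have X: "?X = e_map q (\<chi> x. a * v $ x)"
    proof -
      have "a *\<^sub>R w = (\<chi> x. (\<chi> x. a * v $ x) $ x + - (a * expect q v))"
        by (simp add: w e_transport_def vec_eq_iff algebra_simps)
      then show ?thesis using e_map_shift[OF qd] by metis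
    qed
    have Xh: "expect q (\<chi> x. ?g $ x * h $ x) / expect q ?g = pairing q (\<chi> x. ?X $ x / q $ x) h"
      unfolding pairing_density_ratio[OF qd] X by (simp add: expect_e_map[OF qd])
    have wh: "expect q (\<chi> x. w $ x * h $ x) = expect q (\<chi> x. v $ x * h $ x)"
      using h by (simp add: w e_transport_def left_diff_distrib expect_diff expect_cmul fiber_def)
    have "pairing q (\<chi> x. c * (inverse a * (?X $ x / q $ x - 1)
         - w $ x - b * nat_grad f q $ x)) h
      = c * (inverse a * pairing q (\<chi> x. ?X $ x / q $ x) h
         - expect q (\<chi> x. w $ x * h $ x) - b * pairing q (nat_grad f q) h)"
      using h by (simp add: pairing_def left_diff_distrib mult.assoc expect_diff expect_cmul fiber_def)
    moreover have "inverse a * (r - a * s) = inverse a * r - s" for r s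
      using a by (simp add: algebra_simps)
    ultimately show ?thesis by (simp only: C Fk Xh wh)
  qed
  ultimately show ?thesis by (intro exI[of _ ?D]) blast
qed

text \<open>
  The derivative within a fiber is determined only in directions tangent to it, which is seen by
  restricting to lines in the fiber.
\<close>

lemma fiber_derivative_unique:
  assumes D: "(F has_derivative D) (at u within fiber p)" and E: "(F has_derivative E) (at u)"
    and u: "u \<in> fiber p" and k: "k \<in> fiber p"
  shows "D k = E k"
proof -
  have lin: "linear (expect p)" by (rule bounded_linear.linear[OF bounded_linear_expect])
  have c: "((\<lambda>s::real. u + s *\<^sub>R k) has_derivative (\<lambda>s. s *\<^sub>R k)) (at 0)"
    by (auto intro!: derivative_eq_intros)
  have ran: "range (\<lambda>s::real. u + s *\<^sub>R k) \<subseteq> fiber p"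
    using u k by (auto simp: fiber_def linear_add[OF lin] linear_cmul[OF lin])
  have "((\<lambda>s. F (u + s *\<^sub>R k)) has_derivative (\<lambda>s. D (s *\<^sub>R k))) (at 0)"
    by (rule has_derivative_in_compose[OF c, of F D]) (use has_derivative_subset[OF D ran] in simp)
  moreover have "((\<lambda>s. F (u + s *\<^sub>R k)) has_derivative (\<lambda>s. E (s *\<^sub>R k))) (at 0)"
    by (rule has_derivative_compose[OF c, of F E]) (use E in simp)
  ultimately have "(\<lambda>s. D (s *\<^sub>R k)) = (\<lambda>s. E (s *\<^sub>R k))"
    by (rule has_derivative_unique)
  from fun_cong[OF this, of 1] show ?thesis by simp
qed

text \<open>
  The chart computation shows that the right-hand side satisfies the defining condition in every
  chart. The chart centred at \<open>q\<close>, with \<open>u = 0\<close> and \<open>v = w\<close>, alone already determines the gradient.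
\<close>

lemma grad_lagrangian:
  assumes f: "smooth_field f" and a: "a > 0" and q: "q \<in> densities" and w: "w \<in> fiber q"
  shows "grad (lagrangian a b c f) q w =
    (\<chi> x. c * (inverse a * (e_map q (a *\<^sub>R w) $ x / q $ x - 1) - w $ x - b * nat_grad f q $ x))"
    (is "_ = ?\<eta>")
proof -
  let ?L = "lagrangian a b c f"
  have fib: "?\<eta> \<in> fiber q"
    using density_ratio_in_fiber[OF q e_map_densities[OF q], of "inverse a"] w nat_grad_chart(1)[OF f q]
    by (simp add: fiber_def expect_cmul expect_diff)
  have e0: "e_map q 0 = q" by (rule e_map_zero[OF q])
  have z: "0 \<in> fiber q" by (simp add: fiber_def expect_def)
  show ?thesis
    unfolding grad_def
  proof (rule the_equality, intro conjI ballI impI)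
    show "?\<eta> \<in> fiber q" by (rule fib)
  next
    fix p u v
    assume p: "p \<in> densities" and "q = e_map p u \<and> w = e_transport p q v"
    then have qw: "q = e_map p u" "w = e_transport p q v" by auto
    from in_chart_lagrangian_has_derivative[OF f a p qw, where b = b and c = c]
    obtain D where D: "((\<lambda>u'. in_chart ?L p u' v) has_derivative D) (at u)"
      "\<forall>h\<in>fiber q. D (e_transport q p h) = pairing q ?\<eta> h" by blast
    then show "\<exists>D. ((\<lambda>u'. in_chart ?L p u' v) has_derivative D) (at u within fiber p) \<and>
             (\<forall>h\<in>fiber q. pairing q ?\<eta> h = D (e_transport q p h))"
      using has_derivative_at_withinI[OF D(1)] by (intro exI[of _ D]) simp
  next
    fix \<eta>
    assume "\<eta> \<in> fiber q \<and> (\<forall>p\<in>densities. \<forall>u\<in>fiber p. \<forall>v\<in>fiber p.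
        q = e_map p u \<and> w = e_transport p q v \<longrightarrow>
        (\<exists>D. ((\<lambda>u'. in_chart ?L p u' v) has_derivative D) (at u within fiber p) \<and>
             (\<forall>h\<in>fiber q. pairing q \<eta> h = D (e_transport q p h))))"
    then have \<eta>: "\<eta> \<in> fiber q" and H: "\<forall>p\<in>densities. \<forall>u\<in>fiber p. \<forall>v\<in>fiber p.
        q = e_map p u \<and> w = e_transport p q v \<longrightarrow>
        (\<exists>D. ((\<lambda>u'. in_chart ?L p u' v) has_derivative D) (at u within fiber p) \<and>
             (\<forall>h\<in>fiber q. pairing q \<eta> h = D (e_transport q p h)))"
      by blast+
    from e_transport_fiber[OF w, of q] e0 H[rule_format, OF q z w]
    obtain D where D: "((\<lambda>u'. in_chart ?L q u' w) has_derivative D) (at 0 within fiber q)"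
      "\<forall>h\<in>fiber q. pairing q \<eta> h = D (e_transport q q h)" by auto
    from in_chart_lagrangian_has_derivative[OF f a q e0[symmetric] e_transport_fiber[OF w, of q, symmetric],
          where b = b and c = c]
    obtain E where E: "((\<lambda>u'. in_chart ?L q u' w) has_derivative E) (at 0)"
      "\<forall>h\<in>fiber q. E (e_transport q q h) = pairing q ?\<eta> h" by blast
    show "\<eta> = ?\<eta>"
    proof (rule pairing_nondegenerate[OF q \<eta> fib])
      fix h assume "h \<in> fiber q"
      then show "pairing q \<eta> h = pairing q ?\<eta> h"
        using D(2) E(2) fiber_derivative_unique[OF D(1) E(1) z centred_in_fiber[OF q, of q h]] by simp
    qed
  qed
qed

section \<open>Equivalence with the first-order system\<close>

text \<open>
  This is where second derivatives of the curve enter: \<open>\<chi>\<close> depends on the velocity.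
\<close>

lemma e_map_velocity_differentiable:
  assumes "smooth_curve I q" "t \<in> I"
  shows "\<exists>Y. ((\<lambda>s. e_map (q s) (a *\<^sub>R velocity q s)) has_vector_derivative Y) (at t)"
proof -
  have q: "q t \<in> densities" by (rule smooth_curve_densities[OF assms])
  obtain Q where Q: "((\<lambda>s. vector_derivative q (at s)) has_vector_derivative Q) (at t)"
    using smooth_curve_vector_derivative(2)[OF assms] by blast
  have dQ: "((\<lambda>s. vector_derivative q (at s) $ x) has_real_derivative Q $ x) (at t)" for x
    using Q by (simp add: has_vector_derivative_vec_iff)
  have dq: "((\<lambda>s. q s $ x) has_real_derivative vector_derivative q (at t) $ x) (at t)" for x
    using smooth_curve_vector_derivative(1)[OF assms] by (simp add: has_vector_derivative_vec_iff)
  define V where "V x = (Q $ x * q t $ x - vector_derivative q (at t) $ x * vector_derivative q (at t) $ x)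
    / (q t $ x * q t $ x)" for x
  have "((\<lambda>s. velocity q s $ x) has_real_derivative V x) (at t)" for x
    unfolding velocity_def V_def using DERIV_divide[OF dQ dq densities_nz[OF q]] by simp
  then have dv: "((\<lambda>s. a * velocity q s $ x) has_real_derivative a * V x) (at t)" for x
    by (rule DERIV_cmult)
  have dg: "((\<lambda>s. exp (a * velocity q s $ x) * q s $ x) has_real_derivative
      exp (a * velocity q t $ x) * (a * V x) * q t $ x
        + vector_derivative q (at t) $ x * exp (a * velocity q t $ x)) (at t)" for x
    by (rule DERIV_mult[OF DERIV_fun_exp[OF dv] dq])
  define S where "S s = expect (q s) (\<chi> x. exp (a * velocity q s $ x))" for s
  have "\<exists>S'. (S has_real_derivative S') (at t)"
    unfolding S_def expect_def vec_lambda_beta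
    by (rule exI, rule DERIV_cdivide, rule DERIV_sum, rule dg)
  then obtain S' where S': "(S has_real_derivative S') (at t)" ..
  have St: "S t > 0" unfolding S_def by (rule expect_exp_pos[OF q])
  have "\<exists>y. ((\<lambda>s. exp (a * velocity q s $ x) * q s $ x / S s) has_real_derivative y) (at t)" for x
    using DERIV_divide[OF dg S'] St by auto
  then obtain y where
    "\<And>x. ((\<lambda>s. exp (a * velocity q s $ x) * q s $ x / S s) has_real_derivative y x) (at t)"
    by metis
  then have *: "((\<lambda>s. \<chi> x. exp (a * velocity q s $ x) * q s $ x / S s)
      has_vector_derivative (\<chi> x. y x)) (at t)"
    by (simp add: has_vector_derivative_vec_iff)
  have eq: "(\<chi> x. exp (a * velocity q s $ x) * q s $ x / S s) = e_map (q s) (a *\<^sub>R velocity q s)"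
    if "s \<in> I" for s
    by (simp add: vec_eq_iff e_map_nth[OF smooth_curve_densities[OF assms(1) that]] S_def)
  show ?thesis
    by (rule exI, rule has_vector_derivative_transform_within_open[OF * smooth_curve_open[OF assms(1)] assms(2)],
        rule eq)
qed

text \<open>
  The inverse of the exponential chart at \<open>q\<close>, rescaled by \<open>a\<close>.
\<close>

lemma velocity_from_e_map:
  assumes a: "a > 0" and q: "q \<in> densities" and w: "w \<in> fiber q" and X: "X \<in> densities"
  shows "w = (\<chi> x. inverse a * (ln (X $ x / q $ x) - expect q (\<chi> y. ln (X $ y / q $ y))))
    \<longleftrightarrow> X = e_map q (a *\<^sub>R w)"
proof
  assume *: "w = (\<chi> x. inverse a * (ln (X $ x / q $ x) - expect q (\<chi> y. ln (X $ y / q $ y))))"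
  have "e_map q (a *\<^sub>R w) = X"
    by (rule e_map_eqI[OF q X, of _ "- expect q (\<chi> y. ln (X $ y / q $ y))"]) (use a in \<open>subst *, simp\<close>)
  then show "X = e_map q (a *\<^sub>R w)" ..
next
  assume "X = e_map q (a *\<^sub>R w)"
  then show "w = (\<chi> x. inverse a * (ln (X $ x / q $ x) - expect q (\<chi> y. ln (X $ y / q $ y))))"
    using w a by (simp add: vec_eq_iff ln_e_map_ratio[OF q] expect_diff expect_const[OF q] expect_cmul fiber_def)
qed

text \<open>
  The mixture derivative of the momentum is \<open>c (\<chi>'/q - q'/q)\<close>, because the contributions of the
  derivative of \<open>1/q\<close> cancel against the product with the velocity; the remaining \<open>q'/q\<close> cancels
  against the term \<open>-w\<close> of the gradient.
\<close>

lemma euler_lagrange_pointwise: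
  assumes a: "a > 0" and c: "c > 0" and f: "smooth_field f" and q: "smooth_curve I q" and t: "t \<in> I"
  defines "X \<equiv> \<lambda>s. e_map (q s) (a *\<^sub>R velocity q s)"
  shows "mixture_deriv q (\<lambda>s. grad_e (lagrangian a b c f) (q s) (velocity q s)) t =
      grad (lagrangian a b c f) (q t) (velocity q t) \<longleftrightarrow>
    (X has_vector_derivative fst (system_field a b f (X t, q t))) (at t)"
proof -
  have qt: "q t \<in> densities" by (rule smooth_curve_densities[OF q t])
  obtain Y where Y: "(X has_vector_derivative Y) (at t)"
    using e_map_velocity_differentiable[OF q t] unfolding X_def by blast
  define v where "v = vector_derivative q (at t)"
  have dX: "((\<lambda>s. X s $ x) has_real_derivative Y $ x) (at t)" for x
    using Y by (simp add: has_vector_derivative_vec_iff)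
  have dq: "((\<lambda>s. q s $ x) has_real_derivative v $ x) (at t)" for x
    using smooth_curve_vector_derivative(1)[OF q t] by (simp add: has_vector_derivative_vec_iff v_def)
  define E where "E = (\<chi> x. c * ((Y $ x * q t $ x - X t $ x * v $ x) / (q t $ x * q t $ x)))"
  have *: "((\<lambda>s. \<chi> x. c * (X s $ x / q s $ x - 1)) has_vector_derivative E) (at t)"
    unfolding has_vector_derivative_vec_iff E_def
    by (auto intro!: derivative_eq_intros dX dq densities_nz[OF qt])
  have momentum: "(\<chi> x. c * (X s $ x / q s $ x - 1)) = grad_e (lagrangian a b c f) (q s) (velocity q s)"
    if "s \<in> I" for s
    by (simp add: grad_e_lagrangian[OF smooth_curve_densities[OF q that] a] X_def)
  then have "((\<lambda>s. grad_e (lagrangian a b c f) (q s) (velocity q s)) has_vector_derivative E) (at t)"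
    by (rule has_vector_derivative_transform_within_open[OF * smooth_curve_open[OF q] t])
  then have lhs: "vector_derivative (\<lambda>s. grad_e (lagrangian a b c f) (q s) (velocity q s)) (at t) = E"
    by (rule vector_derivative_at)
  have "mixture_deriv q (\<lambda>s. grad_e (lagrangian a b c f) (q s) (velocity q s)) t =
      (\<chi> x. c * (Y $ x / q t $ x - velocity q t $ x))"
    using densities_nz[OF qt]
    unfolding mixture_deriv_def lhs momentum[OF t, symmetric]
    by (simp add: vec_eq_iff E_def velocity_def field_simps flip: v_def)
  moreover have "grad (lagrangian a b c f) (q t) (velocity q t) =
    (\<chi> x. c * (inverse a * (X t $ x / q t $ x - 1) - velocity q t $ x - b * nat_grad f (q t) $ x))"
    unfolding X_def by (rule grad_lagrangian[OF f a qt velocity_in_fiber[OF q t]])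
  ultimately have "mixture_deriv q (\<lambda>s. grad_e (lagrangian a b c f) (q s) (velocity q s)) t =
      grad (lagrangian a b c f) (q t) (velocity q t) \<longleftrightarrow>
    (\<forall>x. Y $ x / q t $ x = inverse a * (X t $ x / q t $ x - 1) - b * nat_grad f (q t) $ x)"
    using c by (auto simp: vec_eq_iff)
  also have "\<dots> \<longleftrightarrow> (\<forall>x. Y $ x = inverse a * (X t $ x - q t $ x) - b * q t $ x * nat_grad f (q t) $ x)"
    using densities_nz[OF qt] a by (simp add: field_simps)
  also have "\<dots> \<longleftrightarrow> Y = fst (system_field a b f (X t, q t))"
    by (simp add: system_field_def vec_eq_iff)
  also have "\<dots> \<longleftrightarrow> (X has_vector_derivative fst (system_field a b f (X t, q t))) (at t)"
    using Y vector_derivative_unique_at by metis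
  finally show ?thesis .
qed

lemma second_equation_pointwise:
  assumes a: "a > 0" and q: "smooth_curve I q" and t: "t \<in> I" and X: "X \<in> densities"
  shows "(q has_vector_derivative snd (system_field a b f (X, q t))) (at t) \<longleftrightarrow>
    X = e_map (q t) (a *\<^sub>R velocity q t)"
proof -
  have qt: "q t \<in> densities" by (rule smooth_curve_densities[OF q t])
  have "(q has_vector_derivative snd (system_field a b f (X, q t))) (at t) \<longleftrightarrow>
      vector_derivative q (at t) = snd (system_field a b f (X, q t))"
    using smooth_curve_vector_derivative(1)[OF q t] vector_derivative_at by metis
  also have "\<dots> \<longleftrightarrow> velocity q t =
      (\<chi> x. inverse a * (ln (X $ x / q t $ x) - expect (q t) (\<chi> y. ln (X $ y / q t $ y))))"
    using densities_nz[OF qt] by (simp add: vec_eq_iff velocity_def system_field_def divide_eq_eq mult_ac)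
  also have "\<dots> \<longleftrightarrow> X = e_map (q t) (a *\<^sub>R velocity q t)"
    by (rule velocity_from_e_map[OF a qt velocity_in_fiber[OF q t] X])
  finally show ?thesis .
qed

lemma has_vector_derivative_pair_iff:
  "((\<lambda>s. (X s, q s)) has_vector_derivative z) (at t) \<longleftrightarrow>
    (X has_vector_derivative fst z) (at t) \<and> (q has_vector_derivative snd z) (at t)"
proof
  assume *: "((\<lambda>s. (X s, q s)) has_vector_derivative z) (at t)"
  from bounded_linear.has_vector_derivative[OF bounded_linear_fst *]
    bounded_linear.has_vector_derivative[OF bounded_linear_snd *]
  show "(X has_vector_derivative fst z) (at t) \<and> (q has_vector_derivative snd z) (at t)" by simp
qed (use has_vector_derivative_Pair[of X "fst z" t UNIV q "snd z"] in simp)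

text \<open>
  The second equation identifies \<open>X\<close> with \<open>e\<^sub>q(a q'/q)\<close> on all of \<open>I\<close>. As \<open>I\<close> is open, the two curves
  then have the same derivatives, which turns the first equation into the Euler--Lagrange equation.
\<close>

lemma solves_system_iff:
  assumes a: "a > 0" and c: "c > 0" and f: "smooth_field f" and q: "smooth_curve I q"
    and X: "\<And>t. t \<in> I \<Longrightarrow> X t \<in> densities"
  shows "solves_system a b f I X q \<longleftrightarrow> euler_lagrange (lagrangian a b c f) I q \<and>
    (\<forall>t\<in>I. X t = e_map (q t) (a *\<^sub>R velocity q t))"
proof -
  let ?Y = "\<lambda>t. e_map (q t) (a *\<^sub>R velocity q t)"
  have "solves_system a b f I X q \<longleftrightarrow>
      (\<forall>t\<in>I. (X has_vector_derivative fst (system_field a b f (X t, q t))) (at t)) \<and> (\<forall>t\<in>I. X t = ?Y t)"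
    unfolding solves_system_def has_vector_derivative_pair_iff
    using second_equation_pointwise[OF a q _ X] by blast
  moreover have "(X has_vector_derivative fst (system_field a b f (X t, q t))) (at t) \<longleftrightarrow>
      (?Y has_vector_derivative fst (system_field a b f (?Y t, q t))) (at t)"
    if eq: "\<forall>t\<in>I. X t = ?Y t" and t: "t \<in> I" for t
  proof -
    have Xt: "X t = ?Y t" using eq t by blast
    show ?thesis unfolding Xt
    proof
      assume "(X has_vector_derivative fst (system_field a b f (?Y t, q t))) (at t)"
      from has_vector_derivative_transform_within_open[OF this smooth_curve_open[OF q] t]
      show "(?Y has_vector_derivative fst (system_field a b f (?Y t, q t))) (at t)"
        using eq by simp
    next
      assume "(?Y has_vector_derivative fst (system_field a b f (?Y t, q t))) (at t)"
      from has_vector_derivative_transform_within_open[OF this smooth_curve_open[OF q] t]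
      show "(X has_vector_derivative fst (system_field a b f (?Y t, q t))) (at t)"
        using eq by simp
    qed
  qed
  ultimately show ?thesis
    unfolding euler_lagrange_def using euler_lagrange_pointwise[OF a c f q] by blast
qed

text \<open>
  If the second component vanishes, \<open>ln (X/q)\<close> is constant, so \<open>X\<close> and \<open>q\<close> both equal \<open>e_map q 0\<close>.
\<close>

lemma system_field_zero_iff:
  assumes a: "a > 0" and b: "b > 0" and X: "X \<in> densities" and q: "q \<in> densities"
  shows "system_field a b f (X, q) = 0 \<longleftrightarrow> X = q \<and> nat_grad f q = 0"
proof
  assume *: "system_field a b f (X, q) = 0"
  define E where "E = expect q (\<chi> y. ln (X $ y / q $ y))"
  have "snd (system_field a b f (X, q)) $ x = inverse a * q $ x * (ln (X $ x / q $ x) - E)" for x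
    by (simp add: system_field_def E_def)
  then have "inverse a * q $ x * (ln (X $ x / q $ x) - E) = 0" for x
    using * by simp
  then have "ln (X $ x / q $ x) = E" for x
    using a densities_nz[OF q, of x] by (metis eq_iff_diff_eq_0 inverse_nonzero_iff_nonzero less_irrefl
        mult_eq_0_iff)
  then have "e_map q 0 = X"
    by (intro e_map_eqI[OF q X, where m = "- E"]) simp
  then have "X = q" by (simp add: e_map_zero[OF q])
  moreover have "fst (system_field a b f (q, q)) $ x = - (b * q $ x * nat_grad f q $ x)" for x
    by (simp add: system_field_def)
  ultimately have "nat_grad f q $ x = 0" for x
    using * b densities_nz[OF q, of x] by auto
  then show "X = q \<and> nat_grad f q = 0"
    using \<open>X = q\<close> by (simp add: vec_eq_iff)
next
  assume "X = q \<and> nat_grad f q = 0"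
  then show "system_field a b f (X, q) = 0"
    using densities_nz[OF q] expect_const[OF q, of 0] by (simp add: system_field_def vec_eq_iff zero_prod_def)
qed

theorem mainTheorem6:
  fixes a b c :: real and f :: "real ^ 'n \<Rightarrow> real"
  assumes "a > 0" and "b > 0" and "c > 0" and "smooth_field f"
  shows "(\<forall>I q. smooth_curve I q \<longrightarrow>
            (euler_lagrange (lagrangian a b c f) I q \<longleftrightarrow>
              solves_system a b f I (\<lambda>t. e_map (q t) (a *\<^sub>R velocity q t)) q) \<and>
            (\<forall>X. (\<forall>t\<in>I. X t \<in> densities) \<longrightarrow>
              (solves_system a b f I X q \<longleftrightarrow>
                euler_lagrange (lagrangian a b c f) I q \<and>
                (\<forall>t\<in>I. X t = e_map (q t) (a *\<^sub>R velocity q t))))) \<and>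
         (\<forall>X\<in>densities. \<forall>q\<in>densities.
            system_field a b f (X, q) = 0 \<longleftrightarrow> X = q \<and> nat_grad f q = 0)"
proof (intro conjI allI ballI impI)
  fix I and q :: "real \<Rightarrow> real ^ 'n"
  assume q: "smooth_curve I q"
  note iff = solves_system_iff[OF assms(1,3,4) q]
  show "euler_lagrange (lagrangian a b c f) I q \<longleftrightarrow>
      solves_system a b f I (\<lambda>t. e_map (q t) (a *\<^sub>R velocity q t)) q"
    by (simp add: iff e_map_densities smooth_curve_densities[OF q])
  show "solves_system a b f I X q \<longleftrightarrow>
      euler_lagrange (lagrangian a b c f) I q \<and> (\<forall>t\<in>I. X t = e_map (q t) (a *\<^sub>R velocity q t))"
    if "\<forall>t\<in>I. X t \<in> densities" for X
    using iff that by blast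
qed (rule system_field_zero_iff[OF assms(1,2)])

end
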